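(* Every second-order equational presentation $\mathcal{E}$ is isomorphic, in the category $\mathcal{SOEP}$, to the second-order equational presentation $\mathcal{E}(\mathbb{M}(\mathcal{E}))$, the internal language of its associated algebraic theory $\mathbb{M}\to\mathbb{M}(\mathcal{E})$.
   Context: Syntax. A (unityped second-order) signature $\Sigma$ is a set of operators each with an arity $\mathsf{o}:\langle n_1,\dots,n_k\rangle\in\mathbb{N}^*$. Terms $\Theta\rhd\Gamma\vdash t$, in a context of metavariables $\Theta=(\mathsf{m}_1:[m_1],\dots,\mathsf{m}_k:[m_k])$ with arities and variables $\Gamma$, are generated by: $x\in\Gamma$; $\mathsf{m}[t_1,\dots,t_m]$ for $(\mathsf{m}:[m])\in\Theta$; $\mathsf{o}((\vec x_1)t_1,\dots,(\vec x_k)t_k)$ with $\Theta\rhd\Gamma,\vec x_i\vdash t_i$, $|\vec x_i|=n_i$, $\vec x_i$ bound; modulo $\alpha$-equivalence. Metasubstitution $t\{\mathsf{m}_i:=(\vec x_i)t_i\}_i$ replaces each $\mathsf{m}_\ell[s_1,\dots,s_{m_\ell}]$ by $t_\ell$ with $x_{\ell,j}$ capture-avoidingly substituted by the metasubstituted $s_j$, commuting with variables and operators. A second-order equational presentation $(\Sigma,E)$ is a signature with a set $E$ of axioms $\Theta\rhd\Gamma\vdash s\equiv t$; derivability from $E$ in second-order equational logic is generated by the axioms, reflexivity, symmetry, transitivity, and: from $\mathsf{m}_1:[m_1],\dots,\mathsf{m}_k:[m_k]\rhd\Gamma\vdash s\equiv t$ and $\Theta\rhd\Delta,\vec x_i\vdash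 s_i\equiv t_i$ ($|\vec x_i|=m_i$) infer $\Theta\rhd\Gamma,\Delta\vdash s\{\mathsf{m}_i:=(\vec x_i)s_i\}\equiv t\{\mathsf{m}_i:=(\vec x_i)t_i\}$. $\mathbb{M}(\mathcal{E})$: objects $\mathbb{N}^*$; morphisms $\langle m_1,\dots,m_k\rangle\to\langle n_1,\dots,n_\ell\rangle$ are tuples of equivalence classes (modulo derivable equality from $E$) $\langle[t_1],\dots,[t_\ell]\rangle$ of terms over $\Sigma$, $t_i$ in context $\mathsf{m}_1:[m_1],\dots,\mathsf{m}_k:[m_k]\rhd x_1,\dots,x_{n_i}$; identities $\langle[\mathsf{m}_i[x_1,\dots,x_{m_i}]]\rangle_i$; composite of $\langle s_p\rangle_{p\le j}$ then $\langle t_q\rangle_q$ is $\langle t_q\{\mathsf{m}_p:=(x_1,\dots,x_{m_p})s_p\}_p\rangle_q$. $\mathbb{M}$ is $\mathbb{M}(\mathcal{E})$ for the empty presentation; $T:\mathbb{M}\to\mathbb{M}(\mathcal{E})$ is the canonical identity-on-objects functor. Internal language $\mathcal{E}(T)$ of $T:\mathbb{M}\to\mathbb{T}$: for every $f:\langle m_1,\dots,m_k\rangle\to\langle n\rangle$ in $\mathbb{T}$ an operator $\mathsf{o}_f$ of arity $\langle m_1,\dots,m_k,0,\dots,0\rangle$ ($n$ zeros); with $\mathsf{t}_f=\mathsf{o}_f((x_1,\dots,x_{m_1})\mathsf{m}_1[x_1,\dots,x_{m_1}],\dots,(x_1,\dots,x_{m_k})\mathsf{m}_k[x_1,\dots,x_{m_k}],x_1,\dots,x_n)$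 in context $\mathsf{m}_1:[m_1],\dots,\mathsf{m}_k:[m_k]\rhd x_1,\dots,x_n$, the axioms are $s\equiv\mathsf{t}_{T\langle s\rangle}$ for every $\langle s\rangle:\langle m_1,\dots,m_k\rangle\to\langle n\rangle$ in $\mathbb{M}$, and $\mathsf{t}_h\equiv\mathsf{t}_g\{\mathsf{m}_i:=(x_1,\dots,x_{n_i})\mathsf{t}_{f_i}\}_{i\le\ell}$ whenever $h=g\circ\langle f_1,\dots,f_\ell\rangle$ in $\mathbb{T}$. $\mathcal{SOEP}$: objects are second-order equational presentations; a morphism $(\Sigma,E)\to(\Sigma',E')$ (syntactic translation) assigns to each $\mathsf{o}:\langle m_1,\dots,m_k\rangle$ of $\Sigma$ a term $\mathsf{m}_1:[m_1],\dots,\mathsf{m}_k:[m_k]\rhd\cdot\vdash\tau_{\mathsf{o}}$ over $\Sigma'$, extended to terms by $\tau(x)=x$, $\tau(\mathsf{m}[t_1,\dots,t_m])=\mathsf{m}[\tau(t_1),\dots,\tau(t_m)]$, $\tau(\mathsf{o}((\vec x_i)t_i)_i)=\tau_{\mathsf{o}}\{\mathsf{m}_i:=(\vec x_i)\tau(t_i)\}_i$, such that for every axiom $\Theta\rhd\Gamma\vdash s\equiv t$ of $E$, $\Theta\rhd\Gamma\vdash\tau(s)\equiv\tau(t)$ is derivable from $E'$. The identity sends $\mathsf{o}$ to $\mathsf{o}(\dots,(x_1,\dots,x_{m_i})\mathsf{m}_i[x_1,\dots,x_{m_i}],\dots)$; the composite of $\tau$ then $\tau'$ sends $\mathsf{o}$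 to $\tau'(\tau_{\mathsf{o}})$.
   Formalization: Syntactic translations are identified when they send each operator to terms derivably equal in the target presentation; with literal equality of the assigned terms the claim fails, e.g. for the presentation with empty signature. *)

theory Defs
  imports Main
begin

text \<open>
  Terms are kept modulo alpha-equivalence by de Bruijn indices. An abstraction
  \<open>(x_1,...,x_n)t\<close> is the pair \<open>(n, t)\<close>; inside \<open>t\<close> the bound variable \<open>x_j\<close> is
  \<open>Var (j - 1)\<close>, and a variable \<open>Var y\<close> of the surrounding context is \<open>Var (y + n)\<close>.
  A context \<open>m_1:[m_1],...,m_k:[m_k] \<rhd> x_1,...,x_n\<close> is given by the list of arities
  \<open>[m_1,...,m_k]\<close> and the number \<open>n\<close>; \<open>Meta i\<close> is the metavariable \<open>m_(i+1)\<close> and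
  \<open>Var j\<close> is the variable \<open>x_(j+1)\<close>.
\<close>

datatype 'o tm =
    Var nat
  | Meta nat "'o tm list"
  | Op 'o "(nat \<times> 'o tm) list"

record 'o signature =
  ops :: "'o set"
  arity :: "'o \<Rightarrow> nat list"

inductive wf_tm :: "('o, 'z) signature_scheme \<Rightarrow> nat list \<Rightarrow> nat \<Rightarrow> 'o tm \<Rightarrow> bool"
  for S :: "('o, 'z) signature_scheme" and \<Theta> :: "nat list"
where
  wf_Var: "x < n \<Longrightarrow> wf_tm S \<Theta> n (Var x)"
| wf_Meta: "i < length \<Theta> \<Longrightarrow> length ts = \<Theta> ! i \<Longrightarrow> (\<And>t. t \<in> set ts \<Longrightarrow> wf_tm S \<Theta> n t)
    \<Longrightarrow> wf_tm S \<Theta> n (Meta i ts)"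
| wf_Op: "f \<in> ops S \<Longrightarrow> map fst as = arity S f
    \<Longrightarrow> (\<And>m t. (m, t) \<in> set as \<Longrightarrow> wf_tm S \<Theta> (m + n) t)
    \<Longrightarrow> wf_tm S \<Theta> n (Op f as)"


subsection \<open>Substitution and metasubstitution\<close>

definition lift_ren :: "nat \<Rightarrow> (nat \<Rightarrow> nat) \<Rightarrow> nat \<Rightarrow> nat" where
  "lift_ren n r = (\<lambda>x. if x < n then x else r (x - n) + n)"

fun ren :: "(nat \<Rightarrow> nat) \<Rightarrow> 'o tm \<Rightarrow> 'o tm" where
  "ren r (Var x) = Var (r x)"
| "ren r (Meta i ts) = Meta i (map (ren r) ts)"
| "ren r (Op f as) = Op f (map (\<lambda>(n, t). (n, ren (lift_ren n r) t)) as)"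

definition lift_sub :: "nat \<Rightarrow> (nat \<Rightarrow> 'o tm) \<Rightarrow> nat \<Rightarrow> 'o tm" where
  "lift_sub n \<sigma> = (\<lambda>x. if x < n then Var x else ren (\<lambda>y. y + n) (\<sigma> (x - n)))"

fun sub :: "(nat \<Rightarrow> 'o tm) \<Rightarrow> 'o tm \<Rightarrow> 'o tm" where
  "sub \<sigma> (Var x) = \<sigma> x"
| "sub \<sigma> (Meta i ts) = Meta i (map (sub \<sigma>) ts)"
| "sub \<sigma> (Op f as) = Op f (map (\<lambda>(n, t). (n, sub (lift_sub n \<sigma>) t)) as)"

text \<open>Weakening of abstractions by \<open>n\<close> new innermost variables of the surrounding context.\<close>

definition weaken_abs :: "nat \<Rightarrow> (nat \<times> 'o tm) list \<Rightarrow> (nat \<times> 'o tm) list" where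
  "weaken_abs n = map (\<lambda>(m, s). (m, ren (lift_ren m (\<lambda>x. x + n)) s))"

text \<open>
  \<open>msub [(m_1, s_1),...,(m_k, s_k)] t\<close> is the metasubstitution
  \<open>t{m_i := (x_1,...,x_(m_i)) s_i}\<close>, where \<open>t\<close> and all the abstractions live in
  the same surrounding variable context.
\<close>

fun msub :: "(nat \<times> 'o tm) list \<Rightarrow> 'o tm \<Rightarrow> 'o tm" where
  "msub \<sigma> (Var x) = Var x"
| "msub \<sigma> (Meta i ts) =
    (let m = fst (\<sigma> ! i); us = map (msub \<sigma>) ts
     in sub (\<lambda>x. if x < m then us ! x else Var (x - m)) (snd (\<sigma> ! i)))"
| "msub \<sigma> (Op f as) = Op f (map (\<lambda>(n, t). (n, msub (weaken_abs n \<sigma>) t)) as)"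


subsection \<open>Equational presentations and second-order equational logic\<close>

type_synonym 'o eqn = "nat list \<times> nat \<times> 'o tm \<times> 'o tm"

record 'o presentation = "'o signature" +
  axioms :: "'o eqn set"

definition wf_presentation :: "'o presentation \<Rightarrow> bool" where
  "wf_presentation P \<longleftrightarrow>
    (\<forall>(\<Theta>, n, s, t) \<in> axioms P. wf_tm P \<Theta> n s \<and> wf_tm P \<Theta> n t)"

text \<open>
  In rule \<open>msub\<close>, \<open>n\<close> is the length of \<open>\<Gamma>\<close> and \<open>d\<close> that of \<open>\<Delta>\<close>. In the joint context
  the variables of \<open>\<Gamma>\<close> are \<open>0,...,n - 1\<close> and those of \<open>\<Delta>\<close> are \<open>n,...,n + d - 1\<close>;
  hence \<open>s\<close> and \<open>t\<close> need no renaming, while the abstractions over \<open>\<Delta>\<close> are weakened by \<open>n\<close>.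
\<close>

inductive derives :: "'o presentation \<Rightarrow> nat list \<Rightarrow> nat \<Rightarrow> 'o tm \<Rightarrow> 'o tm \<Rightarrow> bool"
  for P :: "'o presentation"
where
  ax: "(\<Theta>, n, s, t) \<in> axioms P \<Longrightarrow> derives P \<Theta> n s t"
| refl: "wf_tm P \<Theta> n t \<Longrightarrow> derives P \<Theta> n t t"
| sym: "derives P \<Theta> n s t \<Longrightarrow> derives P \<Theta> n t s"
| trans: "derives P \<Theta> n s t \<Longrightarrow> derives P \<Theta> n t u \<Longrightarrow> derives P \<Theta> n s u"
| msub: "derives P ms n s t \<Longrightarrow> length ss = length ms \<Longrightarrow> length ts = length ms
    \<Longrightarrow> (\<And>i. i < length ms \<Longrightarrow> derives P \<Theta> (ms ! i + d) (ss ! i) (ts ! i))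
    \<Longrightarrow> derives P \<Theta> (n + d)
          (msub (weaken_abs n (zip ms ss)) s) (msub (weaken_abs n (zip ms ts)) t)"


subsection \<open>The algebraic theory of a presentation\<close>

text \<open>Categories whose objects are all lists of natural numbers; \<open>cmp g f\<close> is \<open>g \<circ> f\<close>.\<close>

record 'a arity_cat =
  arr :: "'a set"
  source :: "'a \<Rightarrow> nat list"
  target :: "'a \<Rightarrow> nat list"
  ident :: "nat list \<Rightarrow> 'a"
  cmp :: "'a \<Rightarrow> 'a \<Rightarrow> 'a"

definition hom :: "'a arity_cat \<Rightarrow> nat list \<Rightarrow> nat list \<Rightarrow> 'a set" where
  "hom C ms ns = {f \<in> arr C. source C f = ms \<and> target C f = ns}"

datatype 'o arrow = Arrow (src: "nat list") (tgt: "nat list") (comps: "'o tm set list")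

definition eq_class :: "'o presentation \<Rightarrow> nat list \<Rightarrow> nat \<Rightarrow> 'o tm \<Rightarrow> 'o tm set" where
  "eq_class P \<Theta> n t = {u. derives P \<Theta> n t u}"

definition rep :: "'o tm set \<Rightarrow> 'o tm" where
  "rep c = (SOME t. t \<in> c)"

text \<open>The arrow \<open>\<langle>[t_1],...,[t_l]\<rangle>\<close> from \<open>ms\<close> to \<open>ns\<close>.\<close>

definition arrow_of :: "'o presentation \<Rightarrow> nat list \<Rightarrow> nat list \<Rightarrow> 'o tm list \<Rightarrow> 'o arrow" where
  "arrow_of P ms ns ts = Arrow ms ns (map2 (eq_class P ms) ns ts)"

text \<open>\<open>meta_vars m i\<close> is the term \<open>m_(i+1)[x_1,...,x_m]\<close>.\<close>

definition meta_vars :: "nat \<Rightarrow> nat \<Rightarrow> 'o tm" where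
  "meta_vars m i = Meta i (map Var [0..<m])"

definition generic_metas :: "nat list \<Rightarrow> 'o tm list" where
  "generic_metas ms = map2 meta_vars ms [0..<length ms]"

definition theory_cat :: "'o presentation \<Rightarrow> 'o arrow arity_cat" where
  "theory_cat P = \<lparr>
    arr = {arrow_of P ms ns ts | ms ns ts.
             length ts = length ns \<and> (\<forall>i < length ns. wf_tm P ms (ns ! i) (ts ! i))},
    source = src,
    target = tgt,
    ident = (\<lambda>ns. arrow_of P ns ns (generic_metas ns)),
    cmp = (\<lambda>g f. arrow_of P (src f) (tgt g)
             (map (\<lambda>c. msub (zip (tgt f) (map rep (comps f))) (rep c)) (comps g))) \<rparr>"

text \<open>
  The initial theory \<open>M\<close> is \<open>theory_cat empty_presentation\<close>. The operator type is
  irrelevant there, and is fixed to be \<open>unit\<close>; \<open>embed\<close> reads a term without operators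
  as a term over any other signature.
\<close>

definition empty_presentation :: "unit presentation" where
  "empty_presentation = \<lparr> ops = {}, arity = (\<lambda>_. []), axioms = {} \<rparr>"

definition embed :: "unit tm \<Rightarrow> 'o tm" where
  "embed = map_tm (\<lambda>_. undefined)"

definition canonical_functor :: "'o presentation \<Rightarrow> unit arrow \<Rightarrow> 'o arrow" where
  "canonical_functor P f = arrow_of P (src f) (tgt f) (map (embed \<circ> rep) (comps f))"


subsection \<open>The internal language of a theory\<close>

definition M_proj :: "nat list \<Rightarrow> nat \<Rightarrow> unit arrow" where
  "M_proj ns i = arrow_of empty_presentation ns [ns ! i] [meta_vars (ns ! i) i]"

text \<open>
  \<open>is_tuple C T ms ns fs F\<close> says that \<open>F = \<langle>f_1,...,f_l\<rangle>\<close>, where \<open>ns\<close> is the product of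
  the \<open>[n_i]\<close> with the images under \<open>T\<close> of the projections of \<open>M\<close>.
\<close>

definition is_tuple ::
  "'a arity_cat \<Rightarrow> (unit arrow \<Rightarrow> 'a) \<Rightarrow> nat list \<Rightarrow> nat list \<Rightarrow> 'a list \<Rightarrow> 'a \<Rightarrow> bool" where
  "is_tuple C T ms ns fs F \<longleftrightarrow>
    F \<in> hom C ms ns \<and> length fs = length ns \<and>
    (\<forall>i < length ns. fs ! i \<in> hom C ms [ns ! i] \<and> cmp C (T (M_proj ns i)) F = fs ! i)"

text \<open>The operator \<open>o_f\<close> is the arrow \<open>f\<close> itself, and \<open>op_tm C f\<close> is the term \<open>t_f\<close>.\<close>

definition op_tm :: "'a arity_cat \<Rightarrow> 'a \<Rightarrow> 'a tm" where
  "op_tm C f = Op f (zip (source C f) (generic_metas (source C f))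
                     @ map (\<lambda>j. (0, Var j)) [0..<hd (target C f)])"

definition internal_language :: "'a arity_cat \<Rightarrow> (unit arrow \<Rightarrow> 'a) \<Rightarrow> 'a presentation" where
  "internal_language C T = \<lparr>
    ops = (\<Union>ms. \<Union>n. hom C ms [n]),
    arity = (\<lambda>f. source C f @ replicate (hd (target C f)) 0),
    axioms =
      {(ms, n, embed s, op_tm C (T (arrow_of empty_presentation ms [n] [s]))) | ms n s.
         wf_tm empty_presentation ms n s} \<union>
      {(ms, n, op_tm C h, msub (zip ns (map (op_tm C) fs)) (op_tm C g)) | ms ns n fs F g h.
         is_tuple C T ms ns fs F \<and> g \<in> hom C ns [n] \<and> h = cmp C g F} \<rparr>"


subsection \<open>The category of presentations and syntactic translations\<close>

type_synonym ('o, 'p) translation = "'o \<Rightarrow> 'p tm"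

fun translate :: "('o, 'p) translation \<Rightarrow> 'o tm \<Rightarrow> 'p tm" where
  "translate \<tau> (Var x) = Var x"
| "translate \<tau> (Meta i ts) = Meta i (map (translate \<tau>) ts)"
| "translate \<tau> (Op f as) = msub (map (\<lambda>(n, t). (n, translate \<tau> t)) as) (\<tau> f)"

definition is_translation ::
  "'o presentation \<Rightarrow> 'p presentation \<Rightarrow> ('o, 'p) translation \<Rightarrow> bool" where
  "is_translation P Q \<tau> \<longleftrightarrow>
    (\<forall>f \<in> ops P. wf_tm Q (arity P f) 0 (\<tau> f)) \<and>
    (\<forall>(\<Theta>, n, s, t) \<in> axioms P. derives Q \<Theta> n (translate \<tau> s) (translate \<tau> t))"

definition id_translation :: "'o presentation \<Rightarrow> ('o, 'o) translation" where
  "id_translation P f = Op f (zip (arity P f) (generic_metas (arity P f)))"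

definition comp_translation ::
  "('p, 'q) translation \<Rightarrow> ('o, 'p) translation \<Rightarrow> ('o, 'q) translation" where
  "comp_translation \<tau>' \<tau> f = translate \<tau>' (\<tau> f)"

text \<open>
  Terms that are derivably equal in the target presentation present the same morphism.
  Without this identification a presentation with no operators, for instance, would not be
  isomorphic to its internal language.
\<close>

definition same_morphism ::
  "'o presentation \<Rightarrow> 'p presentation \<Rightarrow> ('o, 'p) translation \<Rightarrow> ('o, 'p) translation \<Rightarrow> bool" where
  "same_morphism P Q \<tau> \<tau>' \<longleftrightarrow> (\<forall>f \<in> ops P. derives Q (arity P f) 0 (\<tau> f) (\<tau>' f))"

definition SOEP_isomorphic :: "'o presentation \<Rightarrow> 'p presentation \<Rightarrow> bool" where
  "SOEP_isomorphic P Q \<longleftrightarrow>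
    wf_presentation P \<and> wf_presentation Q \<and>
    (\<exists>\<tau> \<rho>. is_translation P Q \<tau> \<and> is_translation Q P \<rho> \<and>
       same_morphism P P (comp_translation \<rho> \<tau>) (id_translation P) \<and>
       same_morphism Q Q (comp_translation \<tau> \<rho>) (id_translation Q))"

end

theory Submission
  imports Defs
begin

text \<open>
  Write \<open>\<lceil>t\<rceil>\<close> for the term \<open>t_f\<close> of the internal language whose operator is the class
  \<open>f = [t]\<close>. The two families of axioms say that \<open>\<lceil>_\<rceil>\<close> is the identity on terms without
  operators and commutes with metasubstitution. One translation sends an operator \<open>o\<close> to
  \<open>\<lceil>o(..., (x)m_i[x], ...)\<rceil>\<close>; the other sends an arrow to a representative in which the
  variables \<open>x_j\<close> are replaced by nullary metavariables. Everything follows from the fact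
  that the translation of any term \<open>t\<close> is derivably equal to \<open>\<lceil>t\<rceil>\<close>, by induction on \<open>t\<close>.
\<close>

section \<open>Renaming, substitution and metasubstitution\<close>

text \<open>The generated rule reaches the arguments of \<open>Op\<close> through the nested list
  and pair types. Here the hypothesis speaks of the members \<open>(m, t)\<close> directly, which
  suits the recursion under binders.\<close>

lemma tm_induct [case_names Var Meta Op]:
  assumes "\<And>x. P (Var x)"
    and "\<And>i ts. (\<And>t. t \<in> set ts \<Longrightarrow> P t) \<Longrightarrow> P (Meta i ts)"
    and "\<And>f as. (\<And>m t. (m, t) \<in> set as \<Longrightarrow> P t) \<Longrightarrow> P (Op f as)"
  shows "P t"
proof (induction t)
  case (Op f as)
  then show ?case
    by (intro assms(3)) fastforce
qed (use assms in auto)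

section \<open>Composition laws for renaming and substitution\<close>

lemma lift_ren_lift_ren: "lift_ren n r (lift_ren n r' x) = lift_ren n (\<lambda>x. r (r' x)) x"
  by (simp add: lift_ren_def)

lemma ren_ren: "ren r (ren r' t) = ren (\<lambda>x. r (r' x)) t"
  by (induction t arbitrary: r r' rule: tm_induct) (auto simp: lift_ren_lift_ren)

lemma lift_sub_lift_ren: "lift_sub n \<sigma> (lift_ren n r x) = lift_sub n (\<lambda>x. \<sigma> (r x)) x"
  by (simp add: lift_sub_def lift_ren_def)

lemma sub_ren: "sub \<sigma> (ren r t) = sub (\<lambda>x. \<sigma> (r x)) t"
  by (induction t arbitrary: \<sigma> r rule: tm_induct) (auto simp: lift_sub_lift_ren)

lemma ren_lift_sub: "ren (lift_ren n r) (lift_sub n \<sigma> x) = lift_sub n (\<lambda>x. ren r (\<sigma> x)) x"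
  by (simp add: lift_sub_def ren_ren) (simp add: lift_ren_def)

lemma ren_sub: "ren r (sub \<sigma> t) = sub (\<lambda>x. ren r (\<sigma> x)) t"
  by (induction t arbitrary: \<sigma> r rule: tm_induct) (auto simp: ren_lift_sub)

lemma lift_sub_lift_sub: "sub (lift_sub n \<theta>) (lift_sub n \<theta>' x) = lift_sub n (\<lambda>x. sub \<theta> (\<theta>' x)) x"
  by (simp add: lift_sub_def[of n \<theta>'] lift_sub_def[of n "\<lambda>x. sub \<theta> (\<theta>' x)"] sub_ren ren_sub)
    (simp add: lift_sub_def)

lemma sub_sub: "sub \<theta> (sub \<theta>' t) = sub (\<lambda>x. sub \<theta> (\<theta>' x)) t"
  by (induction t arbitrary: \<theta> \<theta>' rule: tm_induct) (auto simp: lift_sub_lift_sub)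

lemma lift_sub_Var [simp]: "lift_sub n Var = Var"
  by (auto simp: lift_sub_def)

lemma sub_Var [simp]: "sub Var t = t"
  by (induction t rule: tm_induct) (auto intro!: map_idI)

lemma ren_conv_sub: "ren r t = sub (\<lambda>x. Var (r x)) t"
  using ren_sub[of r Var t] by simp

\<comment> \<open>Well-formed terms under renaming and substitution\<close>
inductive_simps wf_Var_iff [simp]: "wf_tm S \<Theta> n (Var x)"
inductive_simps wf_Meta_iff [simp]: "wf_tm S \<Theta> n (Meta i ts)"
inductive_simps wf_Op_iff [simp]: "wf_tm S \<Theta> n (Op f as)"

text \<open>Only indices below \<open>n\<close> occur free, and lifting under \<open>m\<close>
  binders preserves agreement below \<open>m + n\<close>. This is how closed abstractions come to
  absorb shifts and instantiations.\<close>

lemma sub_cong_wf: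
  assumes "wf_tm S \<Theta> n t" and "\<And>x. x < n \<Longrightarrow> \<sigma> x = \<sigma>' x"
  shows "sub \<sigma> t = sub \<sigma>' t"
  using assms
proof (induction arbitrary: \<sigma> \<sigma>' rule: wf_tm.induct)
  case (wf_Meta i ts n)
  have "sub \<sigma> t = sub \<sigma>' t" if "t \<in> set ts" for t
    by (rule wf_Meta.IH[OF that wf_Meta.prems])
  then show ?case by simp
next
  case (wf_Op f as n)
  have "sub (lift_sub m \<sigma>) t = sub (lift_sub m \<sigma>') t" if "(m, t) \<in> set as" for m t
    using wf_Op(5) by (intro wf_Op.IH[OF that]) (auto simp: lift_sub_def)
  then show ?case by auto
qed simp

lemma ren_id_wf:
  assumes "wf_tm S \<Theta> n t" and "\<And>x. x < n \<Longrightarrow> r x = x"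
  shows "ren r t = t"
proof -
  have "sub (\<lambda>x. Var (r x)) t = sub Var t"
    using assms by (intro sub_cong_wf[OF assms(1)]) simp
  then show ?thesis by (simp add: ren_conv_sub)
qed

lemma wf_ren:
  assumes "wf_tm S \<Theta> n t" and "\<And>x. x < n \<Longrightarrow> r x < n'"
  shows "wf_tm S \<Theta> n' (ren r t)"
  using assms
proof (induction arbitrary: r n' rule: wf_tm.induct)
  case (wf_Op f as n)
  have "wf_tm S \<Theta> (m + n') (ren (lift_ren m r) t)" if "(m, t) \<in> set as" for m t
    using wf_Op(5) by (intro wf_Op.IH[OF that]) (auto simp: lift_ren_def)
  moreover have "map fst (map (\<lambda>(m, t). (m, ren (lift_ren m r) t)) as) = map fst as"
    by auto
  ultimately show ?case using wf_Op.hyps by auto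
qed auto

lemma wf_mono:
  assumes "wf_tm S \<Theta> n t" and "n \<le> n'"
  shows "wf_tm S \<Theta> n' t"
  using wf_ren[OF assms(1), of "\<lambda>x. x" n'] ren_id_wf[OF assms(1), of "\<lambda>x. x"] assms(2)
  by auto

text \<open>Substitution keeps the metavariables of \<open>t\<close> in place, so \<Theta> has to be
  an initial segment of \<open>\<Theta>'\<close>. The terms put in may use the further ones, as they
  do when variables are exchanged for fresh metavariables.\<close>

lemma wf_sub:
  assumes "wf_tm S \<Theta> n t" and "\<And>x. x < n \<Longrightarrow> wf_tm S \<Theta>' n' (\<sigma> x)"
    and "length \<Theta> \<le> length \<Theta>'" and "\<And>i. i < length \<Theta> \<Longrightarrow> \<Theta>' ! i = \<Theta> ! i"
  shows "wf_tm S \<Theta>' n' (sub \<sigma> t)"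
  using assms
proof (induction arbitrary: \<sigma> n' rule: wf_tm.induct)
  case (wf_Op f as n)
  have "wf_tm S \<Theta>' (m + n') (sub (lift_sub m \<sigma>) t)" if "(m, t) \<in> set as" for m t
    using wf_Op.prems
    by (intro wf_Op.IH[OF that]) (auto simp: lift_sub_def intro!: wf_ren[where n = n'])
  moreover have "map fst (map (\<lambda>(m, t). (m, sub (lift_sub m \<sigma>) t)) as) = map fst as"
    by auto
  ultimately show ?case using wf_Op.hyps by auto
qed auto

section \<open>Metasubstitution against renaming and substitution\<close>

text \<open>Generalises \<open>weaken_abs\<close> from shifts to arbitrary renamings: below a binder
  the induction for \<open>ren_msub\<close> meets lifted renamings, which are not shifts.\<close>

definition ren_abs :: "(nat \<Rightarrow> nat) \<Rightarrow> (nat \<times> 'o tm) list \<Rightarrow> (nat \<times> 'o tm) list" where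
  "ren_abs r = map (\<lambda>(m, s). (m, ren (lift_ren m r) s))"

lemma weaken_abs_conv: "weaken_abs n = ren_abs (\<lambda>x. x + n)"
  by (simp add: weaken_abs_def ren_abs_def)

lemma map_fst_ren_abs [simp]: "map fst (ren_abs r \<sigma>) = map fst \<sigma>"
  by (auto simp: ren_abs_def)

lemma length_ren_abs [simp]: "length (ren_abs r \<sigma>) = length \<sigma>"
  by (simp add: ren_abs_def)

lemma ren_abs_ren_abs: "ren_abs r (ren_abs r' \<sigma>) = ren_abs (\<lambda>x. r (r' x)) \<sigma>"
  by (auto simp: ren_abs_def ren_ren lift_ren_lift_ren)

lemma nth_ren_abs:
  "i < length \<sigma> \<Longrightarrow> ren_abs r \<sigma> ! i = (fst (\<sigma> ! i), ren (lift_ren (fst (\<sigma> ! i)) r) (snd (\<sigma> ! i)))"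
  by (simp add: ren_abs_def case_prod_unfold)

text \<open>Names the substitution in the \<open>Meta\<close> clause of \<open>msub\<close>: the
  first \<open>m\<close> indices are the bound variables of the abstraction, the others drop by
  \<open>m\<close> because its binder disappears.\<close>

definition inst :: "nat \<Rightarrow> 'o tm list \<Rightarrow> nat \<Rightarrow> 'o tm" where
  "inst m us = (\<lambda>x. if x < m then us ! x else Var (x - m))"

lemma msub_Meta: "msub \<sigma> (Meta i ts) = sub (inst (fst (\<sigma> ! i)) (map (msub \<sigma>) ts)) (snd (\<sigma> ! i))"
  by (simp add: Let_def inst_def)

declare msub.simps(2) [simp del]

text \<open>Well-formedness makes each metavariable index fall inside \<sigma> and each argument
  list as long as its abstraction, so that \<open>inst\<close> and \<open>lift_ren\<close> split the
  indices at the same point.\<close>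

lemma ren_msub:
  assumes "wf_tm S \<Theta> n t" and "map fst \<sigma> = \<Theta>"
  shows "ren r (msub \<sigma> t) = msub (ren_abs r \<sigma>) (ren r t)"
  using assms
proof (induction arbitrary: \<sigma> r rule: wf_tm.induct)
  case (wf_Meta i ts n)
  define m where "m = fst (\<sigma> ! i)"
  have i: "i < length \<sigma>" and m: "length ts = m"
    using wf_Meta by (auto simp: m_def)
  have IH: "map (ren r) (map (msub \<sigma>) ts) = map (msub (ren_abs r \<sigma>)) (map (ren r) ts)"
    using wf_Meta by auto
  have "ren r (inst m (map (msub \<sigma>) ts) x)
      = inst m (map (ren r) (map (msub \<sigma>) ts)) (lift_ren m r x)" for x
    by (auto simp: inst_def lift_ren_def m)
  then show ?case
    unfolding ren.simps msub_Meta nth_ren_abs[OF i] fst_conv snd_conv IH[symmetric]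
      ren_sub sub_ren m_def by simp
next
  case (wf_Op f as n)
  \<comment> \<open>Shifting past \<open>k\<close> binders and then applying the lifted renaming is
    renaming first and shifting afterwards; hence the two operations on abstractions
    commute.\<close>
  have "lift_ren k r (x + k) = r x + k" for k x
    by (simp add: lift_ren_def)
  then have "weaken_abs k (ren_abs r \<sigma>) = ren_abs (lift_ren k r) (weaken_abs k \<sigma>)" for k
    by (simp add: weaken_abs_conv ren_abs_ren_abs)
  with wf_Op show ?case by (auto simp: weaken_abs_conv)
qed auto

text \<open>
  The interchange law for substitution and metasubstitution. The metavariables of \<open>t\<close>
  form an initial segment of those of the \<open>\<theta> x\<close>, which lets \<open>\<theta>\<close> introduce fresh ones.
\<close>

lemma msub_sub:
  assumes "wf_tm S \<Theta> n t" and "map fst \<sigma> = \<Theta>" and "map fst \<sigma>' = \<Theta>'"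
    and "length \<Theta> \<le> length \<Theta>'"
    and "\<And>x. x < n \<Longrightarrow> wf_tm S \<Theta>' n' (\<theta> x) \<and> msub \<sigma>' (\<theta> x) = \<theta>' x"
    and "\<And>i. i < length \<Theta> \<Longrightarrow>
      \<sigma>' ! i = (fst (\<sigma> ! i), sub (lift_sub (fst (\<sigma> ! i)) \<theta>') (snd (\<sigma> ! i)))"
  shows "msub \<sigma>' (sub \<theta> t) = sub \<theta>' (msub \<sigma> t)"
  using assms
proof (induction arbitrary: \<sigma> \<sigma>' \<theta> \<theta>' n' rule: wf_tm.induct)
  case (wf_Var x n)
  then show ?case by simp
next
  case (wf_Meta i ts n)
  define m where "m = fst (\<sigma> ! i)"
  have i: "i < length \<Theta>" and m: "length ts = m"
    using wf_Meta by (auto simp: m_def)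
  have s: "\<sigma>' ! i = (m, sub (lift_sub m \<theta>') (snd (\<sigma> ! i)))"
    using wf_Meta.prems i by (simp add: m_def)
  have IH: "map (msub \<sigma>') (map (sub \<theta>) ts) = map (sub \<theta>') (map (msub \<sigma>) ts)"
    using wf_Meta.IH[OF _ wf_Meta.prems] by auto
  \<comment> \<open>Both composite substitutions are compared index by index: a bound index selects
    an argument, and for any other the weakening by \<open>m\<close> is cancelled by
    \<open>inst\<close>.\<close>
  have *: "sub (inst m us) (lift_sub m \<theta>' x) = sub \<theta>' (inst m (map (msub \<sigma>) ts) x)"
    if "us = map (sub \<theta>') (map (msub \<sigma>) ts)" for x us
  proof (cases "x < m")
    case True
    then show ?thesis using that m by (simp add: inst_def lift_sub_def)
  next
    case False
    have *: "inst m us (y + m) = Var y" for y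
      by (simp add: inst_def)
    from False show ?thesis by (simp add: lift_sub_def sub_ren *) (simp add: inst_def)
  qed
  show ?case
    unfolding sub.simps msub_Meta s fst_conv snd_conv IH sub_sub m_def[symmetric]
    by (rule arg_cong[of _ _ "\<lambda>\<theta>. sub \<theta> _"]) (use * in \<open>auto simp: fun_eq_iff\<close>)
next
  case (wf_Op f as n)
  have "msub (weaken_abs k \<sigma>') (sub (lift_sub k \<theta>) t)
      = sub (lift_sub k \<theta>') (msub (weaken_abs k \<sigma>) t)" if "(k, t) \<in> set as" for k t
  proof (rule wf_Op.IH[OF that, where n' = "k + n'"])
    show "wf_tm S \<Theta>' (k + n') (lift_sub k \<theta> x) \<and> msub (weaken_abs k \<sigma>') (lift_sub k \<theta> x) = lift_sub k \<theta>' x"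
      if "x < k + n" for x
    proof (cases "x < k")
      case False
      with that have wf: "wf_tm S \<Theta>' n' (\<theta> (x - k))" and
        eq: "msub \<sigma>' (\<theta> (x - k)) = \<theta>' (x - k)"
        using wf_Op.prems(4) by auto
      \<comment> \<open>Beyond the binder the lifted substitutions are weakenings, and
        \<open>ren_msub\<close> moves the weakening across the metasubstitution.\<close>
      show ?thesis
        using False ren_msub[OF wf wf_Op.prems(2), of "\<lambda>y. y + k"] eq wf
        by (auto simp: lift_sub_def weaken_abs_conv intro: wf_ren)
    qed (auto simp: lift_sub_def)
  next
    fix i assume i: "i < length \<Theta>"
    have l: "i < length \<sigma>" "i < length \<sigma>'"
      using wf_Op.prems i by auto
    have "lift_sub k \<theta>' (x + k) = ren (\<lambda>x. x + k) (\<theta>' x)" for x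
      by (simp add: lift_sub_def)
    then show "weaken_abs k \<sigma>' ! i = (fst (weaken_abs k \<sigma> ! i),
       sub (lift_sub (fst (weaken_abs k \<sigma> ! i)) (lift_sub k \<theta>')) (snd (weaken_abs k \<sigma> ! i)))"
      using wf_Op.prems(5)[OF i]
      by (simp add: weaken_abs_conv nth_ren_abs l ren_sub sub_ren ren_lift_sub lift_sub_lift_ren)
  qed (use wf_Op.prems in \<open>auto simp: weaken_abs_conv\<close>)
  then show ?case by auto
qed

lemma wf_msub:
  assumes "wf_tm S \<Theta> n t" and "map fst \<sigma> = \<Theta>"
    and "\<And>m s. (m, s) \<in> set \<sigma> \<Longrightarrow> wf_tm S \<Theta>' (m + n) s"
  shows "wf_tm S \<Theta>' n (msub \<sigma> t)"
  using assms
proof (induction arbitrary: \<sigma> rule: wf_tm.induct)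
  case (wf_Meta i ts n)
  define m where "m = fst (\<sigma> ! i)"
  have i: "i < length \<sigma>" and m: "length ts = m"
    using wf_Meta by (auto simp: m_def)
  have "wf_tm S \<Theta>' (m + n) (snd (\<sigma> ! i))"
    using wf_Meta.prems(2)[of m "snd (\<sigma> ! i)"] i by (simp add: m_def)
  then show ?case
    unfolding msub_Meta m_def[symmetric]
    by (rule wf_sub) (use wf_Meta m in \<open>auto simp: inst_def\<close>)
next
  case (wf_Op f as n)
  have "wf_tm S \<Theta>' (k + n) (msub (weaken_abs k \<sigma>) t)" if "(k, t) \<in> set as" for k t
  proof (rule wf_Op.IH[OF that])
    fix m s assume "(m, s) \<in> set (weaken_abs k \<sigma>)"
    then obtain s' where "(m, s') \<in> set \<sigma>" and s: "s = ren (lift_ren m (\<lambda>x. x + k)) s'"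
      by (auto simp: weaken_abs_def)
    then show "wf_tm S \<Theta>' (m + (k + n)) s"
      using wf_Op.prems(2)[of m s'] by (auto simp: lift_ren_def intro!: wf_ren)
  qed (use wf_Op.prems in \<open>auto simp: weaken_abs_conv\<close>)
  moreover have "map fst (map (\<lambda>(m, t). (m, msub (weaken_abs m \<sigma>) t)) as) = map fst as"
    by auto
  ultimately show ?case using wf_Op.hyps by auto
qed auto

lemma wf_msub_zip:
  assumes "wf_tm S \<Xi> n t" and "length ts = length \<Xi>"
    and "\<And>i. i < length \<Xi> \<Longrightarrow> wf_tm S \<Theta> (\<Xi> ! i) (ts ! i)"
  shows "wf_tm S \<Theta> n (msub (zip \<Xi> ts) t)"
proof (rule wf_msub[OF assms(1)])
  fix m s assume "(m, s) \<in> set (zip \<Xi> ts)"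
  then obtain i where "i < length \<Xi>" "m = \<Xi> ! i" "s = ts ! i"
    by (auto simp: set_zip)
  then show "wf_tm S \<Theta> (m + n) s"
    using wf_mono[OF assms(3)] by simp
qed (use assms(2) in simp)

section \<open>Generic metavariables and unit laws of metasubstitution\<close>

lemma length_generic_metas [simp]: "length (generic_metas ms) = length ms"
  by (simp add: generic_metas_def)

lemma nth_generic_metas [simp]: "i < length ms \<Longrightarrow> generic_metas ms ! i = meta_vars (ms ! i) i"
  by (simp add: generic_metas_def)

text \<open>The bodies have no free variables beyond their own bound ones, and the lifted shift
  fixes those.\<close>

lemma weaken_abs_closed:
  assumes "length ss = length ms" and "\<And>i. i < length ms \<Longrightarrow> wf_tm S \<Theta> (ms ! i) (ss ! i)"
  shows "weaken_abs n (zip ms ss) = zip ms ss"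
proof (rule nth_equalityI)
  fix i assume "i < length (weaken_abs n (zip ms ss))"
  then have i: "i < length ms" using assms by (simp add: weaken_abs_conv)
  have "ren (lift_ren (ms ! i) (\<lambda>x. x + n)) (ss ! i) = ss ! i"
    by (rule ren_id_wf[OF assms(2)[OF i]]) (simp add: lift_ren_def)
  then show "weaken_abs n (zip ms ss) ! i = zip ms ss ! i"
    using i assms(1) by (simp add: weaken_abs_conv nth_ren_abs)
qed (simp add: weaken_abs_conv)

lemma weaken_abs_0 [simp]: "weaken_abs 0 \<sigma> = \<sigma>"
proof -
  have "lift_ren m (\<lambda>x. x) = (\<lambda>x. x)" for m
    by (auto simp: lift_ren_def)
  moreover have "ren (\<lambda>x. x) t = t" for t :: "'a tm"
    by (simp add: ren_conv_sub)
  ultimately show ?thesis by (auto simp: weaken_abs_def map_idI)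
qed

lemma wf_meta_vars [simp]: "wf_tm S \<Theta> n (meta_vars m i) \<longleftrightarrow> i < length \<Theta> \<and> m = \<Theta> ! i \<and> m \<le> n"
proof -
  have "(\<forall>t \<in> Var ` {0..<m}. wf_tm S \<Theta> n t) \<longleftrightarrow> m \<le> n"
    by (auto simp: linorder_not_less)
  then show ?thesis by (auto simp: meta_vars_def)
qed

lemma map_inst: "length us = m \<Longrightarrow> map (inst m us) [0..<m] = us"
  by (auto intro: nth_equalityI simp: inst_def)

lemma msub_meta_vars:
  assumes "fst (\<sigma> ! i) = m"
  shows "msub \<sigma> (meta_vars m i) = sub (inst m (map Var [0..<m])) (snd (\<sigma> ! i))"
  using assms by (simp add: meta_vars_def msub_Meta comp_def)

text \<open>Applying a closed abstraction to its own bound variables returns its body. This is the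
  computation behind the projections of the theory.\<close>

lemma msub_meta_vars_closed:
  assumes "i < length ms" and "length ss = length ms" and "wf_tm S \<Theta> (ms ! i) (ss ! i)"
  shows "msub (zip ms ss) (meta_vars (ms ! i) i) = ss ! i"
proof -
  have "sub (inst (ms ! i) (map Var [0..<ms ! i])) (ss ! i) = sub Var (ss ! i)"
    by (rule sub_cong_wf[OF assms(3)]) (simp add: inst_def)
  then show ?thesis using assms by (simp add: msub_meta_vars)
qed

text \<open>Here the abstraction may mention ambient variables: weakening by \<open>m\<close> moves
  them past the bound ones and \<open>inst\<close> moves them back, so the composite is the identity
  on every index.\<close>

lemma msub_weaken_meta_vars:
  assumes "i < length \<sigma>" and "fst (\<sigma> ! i) = m"
  shows "msub (weaken_abs m \<sigma>) (meta_vars m i) = snd (\<sigma> ! i)"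
proof -
  have *: "inst m (map Var [0..<m]) (lift_ren m (\<lambda>x. x + m) x) = Var x" for x
    by (auto simp: inst_def lift_ren_def)
  show ?thesis
    using assms by (simp add: msub_meta_vars weaken_abs_conv nth_ren_abs sub_ren *)
qed

text \<open>The tuple of generic metavariables is the identity arrow, hence a unit for composition.
  Its abstractions are closed, so the same list reappears below each binder.\<close>

lemma msub_generic_metas:
  assumes "wf_tm S \<Theta> n t"
  shows "msub (zip \<Theta> (generic_metas \<Theta>)) t = t"
  using assms
proof (induction rule: wf_tm.induct)
  case (wf_Meta i ts n)
  have "map (msub (zip \<Theta> (generic_metas \<Theta>))) ts = ts"
    using wf_Meta by (simp add: map_idI)
  with wf_Meta(1,2) show ?case
    by (simp add: msub_Meta meta_vars_def map_inst comp_def)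
next
  case (wf_Op f as n)
  have "weaken_abs k (zip \<Theta> (generic_metas \<Theta> :: 'a tm list)) = zip \<Theta> (generic_metas \<Theta>)" for k
    by (rule weaken_abs_closed[where S = S and \<Theta> = \<Theta>]) auto
  with wf_Op show ?case by (auto intro!: map_idI)
qed simp

text \<open>Computes the arguments of a generic operator application after instantiation. Each one
  sits under its own \<open>m\<close> binders, which accounts for
  \<open>weaken_abs m\<close>.\<close>

lemma msub_args_generic_metas:
  assumes "map fst \<sigma> = ms"
  shows "map (\<lambda>(m, t). (m, msub (weaken_abs m \<sigma>) t)) (zip ms (generic_metas ms)) = \<sigma>"
proof (rule nth_equalityI)
  fix i assume "i < length (map (\<lambda>(m, t). (m, msub (weaken_abs m \<sigma>) t)) (zip ms (generic_metas ms)))"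
  then have "i < length \<sigma>" "i < length ms" "ms ! i = fst (\<sigma> ! i)"
    using assms by auto
  then show "map (\<lambda>(m, t). (m, msub (weaken_abs m \<sigma>) t)) (zip ms (generic_metas ms)) ! i = \<sigma> ! i"
    by (simp add: msub_weaken_meta_vars)
qed (use assms in auto)

lemma msub_id_translation:
  assumes "map fst \<sigma> = arity P f"
  shows "msub \<sigma> (id_translation P f) = Op f \<sigma>"
  using msub_args_generic_metas[OF assms] by (simp add: id_translation_def)

section \<open>Exchanging variables for nullary metavariables\<close>

text \<open>With \<open>k\<close> the number of metavariables already in \<Theta>, this moves a term
  from the context \<Theta> with \<open>n\<close> variables to
  \<open>\<Theta> @ replicate n 0\<close> with none.\<close>

definition fresh_meta :: "nat \<Rightarrow> nat \<Rightarrow> 'o tm" where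
  "fresh_meta k = (\<lambda>x. Meta (k + x) [])"

lemma lift_sub_fresh_meta:
  "lift_sub m (fresh_meta k) = (\<lambda>x. if x < m then Var x else Meta (k + (x - m)) [])"
  by (simp add: lift_sub_def fresh_meta_def fun_eq_iff)

lemma lift_sub_0_fresh_meta: "lift_sub 0 (fresh_meta k) = fresh_meta k"
  by (auto simp: lift_sub_def fresh_meta_def)

lemma wf_sub_fresh_meta:
  assumes "wf_tm S \<Theta> n t"
  shows "wf_tm S (\<Theta> @ replicate n 0) 0 (sub (fresh_meta (length \<Theta>)) t)"
  by (rule wf_sub[OF assms]) (auto simp: fresh_meta_def nth_append)

text \<open>The exchange is undone by instantiating the fresh metavariables with the old variables:
  in the interchange law \<open>msub_sub\<close> the resulting \<open>\<theta>'\<close> is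
  \<open>Var\<close>.\<close>

lemma msub_sub_fresh_meta:
  assumes "wf_tm S \<Theta> n t" and "length ss = length \<Theta>"
  shows "msub (zip \<Theta> ss @ map (\<lambda>j. (0, Var j)) [0..<n]) (sub (fresh_meta (length \<Theta>)) t)
    = msub (zip \<Theta> ss) t"
proof -
  let ?\<sigma>' = "zip \<Theta> ss @ map (\<lambda>j. (0, Var j)) [0..<n]"
  have "msub ?\<sigma>' (sub (fresh_meta (length \<Theta>)) t) = sub Var (msub (zip \<Theta> ss) t)"
  proof (rule msub_sub[OF assms(1), where \<Theta>' = "\<Theta> @ replicate n 0" and n' = 0])
    show "map fst ?\<sigma>' = \<Theta> @ replicate n 0"
      using assms(2) by (simp add: comp_def map_replicate_const)
    show "wf_tm S (\<Theta> @ replicate n 0) 0 (fresh_meta (length \<Theta>) x)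
        \<and> msub ?\<sigma>' (fresh_meta (length \<Theta>) x) = Var x" if "x < n" for x
      using that assms(2) by (simp add: fresh_meta_def nth_append msub_Meta inst_def)
  qed (use assms in \<open>auto simp: nth_append\<close>)
  then show ?thesis by simp
qed

text \<open>As \<open>t\<close> has no variables, \<theta> can act only inside the abstractions;
  this is the interchange law with the inner substitution equal to \<open>Var\<close>.\<close>

lemma sub_msub_closed:
  assumes "wf_tm S \<Theta> 0 t" and "map fst \<sigma> = \<Theta>"
  shows "sub \<theta> (msub \<sigma> t) = msub (map (\<lambda>(m, s). (m, sub (lift_sub m \<theta>) s)) \<sigma>) t"
proof -
  have "msub (map (\<lambda>(m, s). (m, sub (lift_sub m \<theta>) s)) \<sigma>) (sub Var t) = sub \<theta> (msub \<sigma> t)"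
    by (rule msub_sub[OF assms(1), where \<Theta>' = \<Theta> and n' = 0])
      (use assms(2) in \<open>auto simp: case_prod_unfold\<close>)
  then show ?thesis by simp
qed


section \<open>Derivable equality\<close>

lemma derives_wf:
  assumes "wf_presentation P" and "derives P \<Theta> n s t"
  shows "wf_tm P \<Theta> n s \<and> wf_tm P \<Theta> n t"
  using assms(2)
proof induction
  case (ax \<Theta> n s t)
  then show ?case using assms(1) by (auto simp: wf_presentation_def)
next
  case (msub ms n s t ss ts \<Theta> d)
  have *: "wf_tm P \<Theta> (n + d) (Defs.msub (weaken_abs n (zip ms us)) u)"
    if "wf_tm P ms n u" and len: "length us = length ms"
      and us: "\<And>i. i < length ms \<Longrightarrow> wf_tm P \<Theta> (ms ! i + d) (us ! i)" for us u
  proof (rule wf_msub[OF wf_mono[OF that(1)]])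
    fix m r assume "(m, r) \<in> set (weaken_abs n (zip ms us))"
    then obtain i where i: "i < length ms" and m: "m = ms ! i"
      and r: "r = ren (lift_ren m (\<lambda>x. x + n)) (us ! i)"
      using len by (auto simp: weaken_abs_def set_zip)
    \<comment> \<open>The lifted shift fixes the \<open>m\<close> bound indices and moves the
      \<open>d\<close> variables of \<Delta> past the \<open>n\<close> variables of
      \<Gamma>.\<close>
    show "wf_tm P \<Theta> (m + (n + d)) r"
      unfolding r m by (rule wf_ren[OF us[OF i]]) (auto simp: lift_ren_def)
  qed (use len in \<open>auto simp: weaken_abs_conv\<close>)
  show ?case using msub by (auto intro!: *)
qed auto

text \<open>The metasubstitution rule with \<Delta> empty: the abstractions are closed, so the
  weakening in the rule leaves them as they are.\<close>

lemma derives_msub: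
  assumes P: "wf_presentation P" and "derives P \<Xi> n s t"
    and len: "length ss = length \<Xi>" "length ts = length \<Xi>"
    and *: "\<And>i. i < length \<Xi> \<Longrightarrow> derives P \<Theta> (\<Xi> ! i) (ss ! i) (ts ! i)"
  shows "derives P \<Theta> n (msub (zip \<Xi> ss) s) (msub (zip \<Xi> ts) t)"
proof -
  have "weaken_abs n (zip \<Xi> ss) = zip \<Xi> ss" "weaken_abs n (zip \<Xi> ts) = zip \<Xi> ts"
    using len derives_wf[OF P *]
    by (auto intro!: weaken_abs_closed[where S = P and \<Theta> = \<Theta>])
  then show ?thesis
    using derives.msub[OF assms(2) len, of \<Theta> 0] * by simp
qed

text \<open>The metasubstitution rule with \<Gamma> empty, where the weakening is by 0 and the
  abstractions may depend on ambient variables.\<close>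

lemma derives_msub_closed:
  assumes "derives P \<Xi> 0 s t"
    and "length ss = length \<Xi>" "length ts = length \<Xi>"
    and "\<And>i. i < length \<Xi> \<Longrightarrow> derives P \<Theta> (\<Xi> ! i + n) (ss ! i) (ts ! i)"
  shows "derives P \<Theta> n (msub (zip \<Xi> ss) s) (msub (zip \<Xi> ts) t)"
  using derives.msub[OF assms] by simp

text \<open>Instantiating the fresh metavariables by the variables, and those of \<Theta> by
  themselves, is an instance of the metasubstitution rule and restores both terms.\<close>

lemma derives_unfresh_meta:
  assumes d: "derives P (\<Theta> @ replicate n 0) 0
      (sub (fresh_meta (length \<Theta>)) s) (sub (fresh_meta (length \<Theta>)) t)"
    and wf: "wf_tm P \<Theta> n s" "wf_tm P \<Theta> n t"
  shows "derives P \<Theta> n s t"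
proof -
  let ?us = "generic_metas \<Theta> @ map Var [0..<n]"
  have zip: "zip (\<Theta> @ replicate n 0) ?us = zip \<Theta> (generic_metas \<Theta>) @ map (\<lambda>j. (0, Var j)) [0..<n]"
    by (auto intro: nth_equalityI)
  have "derives P \<Theta> n
      (msub (zip (\<Theta> @ replicate n 0) ?us) (sub (fresh_meta (length \<Theta>)) s))
      (msub (zip (\<Theta> @ replicate n 0) ?us) (sub (fresh_meta (length \<Theta>)) t))"
    by (rule derives_msub_closed[OF d]) (auto intro!: derives.refl simp: nth_append)
  then show ?thesis
    unfolding zip
    by (simp add: wf msub_sub_fresh_meta[OF wf(1)] msub_sub_fresh_meta[OF wf(2)]
        msub_generic_metas[OF wf(1)] msub_generic_metas[OF wf(2)])
qed

text \<open>Without axioms every rule preserves syntactic equality. Thus classes in the initial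
  theory are singletons, and \<open>canonical_functor\<close> recovers the very term it is applied
  to.\<close>

lemma derives_empty_presentation:
  assumes "derives empty_presentation \<Theta> n s t"
  shows "s = t"
  using assms
proof induction
  case (msub ms n s t ss ts \<Theta> d)
  then have "ss = ts" by (auto intro: nth_equalityI)
  with msub show ?case by simp
qed (auto simp: empty_presentation_def)

section \<open>Classes, representatives and terms without operators\<close>

lemma eq_class_cong:
  assumes "derives P \<Theta> n s t"
  shows "eq_class P \<Theta> n s = eq_class P \<Theta> n t"
  using assms by (auto simp: eq_class_def intro: derives.trans derives.sym)

text \<open>Reflexivity puts \<open>t\<close> in its own class, so the choice operator has a
  witness.\<close>

lemma derives_rep:
  assumes "wf_tm P \<Theta> n t"
  shows "derives P \<Theta> n t (rep (eq_class P \<Theta> n t))"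
proof -
  have "rep (eq_class P \<Theta> n t) \<in> eq_class P \<Theta> n t"
    unfolding rep_def by (rule someI[of _ t]) (simp add: eq_class_def derives.refl assms)
  then show ?thesis by (simp add: eq_class_def)
qed

lemma embed_simps [simp]:
  "embed (Var x) = Var x"
  "embed (Meta i ts) = Meta i (map embed ts)"
  by (simp_all add: embed_def)

lemma wf_embed:
  assumes "wf_tm empty_presentation \<Theta> n t"
  shows "wf_tm S \<Theta> n (embed t)"
  using assms by induction (auto simp: empty_presentation_def)

lemma translate_embed:
  assumes "wf_tm empty_presentation \<Theta> n t"
  shows "translate \<tau> (embed t) = embed t"
  using assms by induction (auto simp: empty_presentation_def)


section \<open>The algebraic theory and its internal language\<close>

lemma arrow_of_simps [simp]:
  "src (arrow_of P ms ns ts) = ms"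
  "tgt (arrow_of P ms ns ts) = ns"
  "comps (arrow_of P ms ns ts) = map2 (eq_class P ms) ns ts"
  by (simp_all add: arrow_of_def)

abbreviation arrow1 :: "'o presentation \<Rightarrow> nat list \<Rightarrow> nat \<Rightarrow> 'o tm \<Rightarrow> 'o arrow" where
  "arrow1 P ms n t \<equiv> arrow_of P ms [n] [t]"

lemma arrow1_cong: "derives P ms n s t \<Longrightarrow> arrow1 P ms n s = arrow1 P ms n t"
  by (simp add: arrow_of_def eq_class_cong)

lemma mem_hom_theory_cat:
  "F \<in> hom (theory_cat P) ms ns \<longleftrightarrow>
    (\<exists>ts. length ts = length ns \<and> (\<forall>i < length ns. wf_tm P ms (ns ! i) (ts ! i)) \<and>
      F = arrow_of P ms ns ts)"
  by (auto simp: hom_def theory_cat_def)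

lemma mem_hom1_theory_cat:
  "f \<in> hom (theory_cat P) ms [n] \<longleftrightarrow> (\<exists>t. wf_tm P ms n t \<and> f = arrow1 P ms n t)"
  by (auto simp: mem_hom_theory_cat length_Suc_conv)

lemma source_theory_cat [simp]: "source (theory_cat P) = src"
  and target_theory_cat [simp]: "target (theory_cat P) = tgt"
  by (simp_all add: theory_cat_def)

text \<open>Composition is defined through chosen representatives; congruence of metasubstitution
  makes its value independent of them.\<close>

lemma cmp_theory_cat:
  assumes P: "wf_presentation P" and u: "wf_tm P ns k u"
    and len: "length ts = length ns"
    and ts: "\<And>i. i < length ns \<Longrightarrow> wf_tm P ms (ns ! i) (ts ! i)"
  shows "cmp (theory_cat P) (arrow1 P ns k u) (arrow_of P ms ns ts) = arrow1 P ms k (msub (zip ns ts) u)"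
proof -
  let ?rs = "map rep (map2 (eq_class P ms) ns ts)"
  have "derives P ms k (msub (zip ns ts) u) (msub (zip ns ?rs) (rep (eq_class P ns k u)))"
    by (rule derives_msub[OF P derives_rep[OF u]]) (use len ts in \<open>auto intro: derives_rep\<close>)
  then have "arrow1 P ms k (msub (zip ns ts) u) = arrow1 P ms k (msub (zip ns ?rs) (rep (eq_class P ns k u)))"
    by (rule arrow1_cong)
  then show ?thesis by (simp add: theory_cat_def)
qed

lemma canonical_functor_arrow1:
  assumes "wf_tm empty_presentation ms n s"
  shows "canonical_functor P (arrow1 empty_presentation ms n s) = arrow1 P ms n (embed s)"
  using derives_empty_presentation[OF derives_rep[OF assms]]
  by (simp add: canonical_functor_def)

text \<open>The images of the projections are the classes of the generic metavariables, and
  composing one with an arrow extracts the corresponding component.\<close>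

lemma is_tuple_theory_cat:
  assumes P: "wf_presentation P"
  shows "is_tuple (theory_cat P) (canonical_functor P) ms ns fs F \<longleftrightarrow>
    (\<exists>ts. length ts = length ns \<and> (\<forall>i < length ns. wf_tm P ms (ns ! i) (ts ! i)) \<and>
      F = arrow_of P ms ns ts \<and> fs = map2 (arrow1 P ms) ns ts)"
proof -
  have proj: "cmp (theory_cat P) (canonical_functor P (M_proj ns i)) (arrow_of P ms ns ts)
      = arrow1 P ms (ns ! i) (ts ! i)"
    if i: "i < length ns" and len: "length ts = length ns"
      and ts: "\<forall>i < length ns. wf_tm P ms (ns ! i) (ts ! i)" for i ts
  proof -
    have "canonical_functor P (M_proj ns i) = arrow1 P ns (ns ! i) (meta_vars (ns ! i) i)"
      using i by (simp add: M_proj_def canonical_functor_arrow1) (simp add: meta_vars_def comp_def)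
    moreover have "msub (zip ns ts) (meta_vars (ns ! i) i) = ts ! i"
      using i len ts by (intro msub_meta_vars_closed) auto
    ultimately show ?thesis
      using i len ts by (simp add: cmp_theory_cat[OF P])
  qed
  show ?thesis
  proof
    assume "is_tuple (theory_cat P) (canonical_functor P) ms ns fs F"
    then obtain ts where ts: "length ts = length ns" "\<forall>i < length ns. wf_tm P ms (ns ! i) (ts ! i)"
      and F: "F = arrow_of P ms ns ts" and fs: "length fs = length ns"
      "\<And>i. i < length ns \<Longrightarrow> fs ! i = cmp (theory_cat P) (canonical_functor P (M_proj ns i)) F"
      unfolding is_tuple_def mem_hom_theory_cat by metis
    have "fs = map2 (arrow1 P ms) ns ts"
      using ts fs by (intro nth_equalityI) (auto simp: F proj)
    with ts F show "\<exists>ts. length ts = length ns \<and> (\<forall>i < length ns. wf_tm P ms (ns ! i) (ts ! i)) \<and>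
      F = arrow_of P ms ns ts \<and> fs = map2 (arrow1 P ms) ns ts" by blast
  next
    assume "\<exists>ts. length ts = length ns \<and> (\<forall>i < length ns. wf_tm P ms (ns ! i) (ts ! i)) \<and>
      F = arrow_of P ms ns ts \<and> fs = map2 (arrow1 P ms) ns ts"
    then obtain ts where ts: "length ts = length ns" "\<forall>i < length ns. wf_tm P ms (ns ! i) (ts ! i)"
      and F: "F = arrow_of P ms ns ts" and fs: "fs = map2 (arrow1 P ms) ns ts" by blast
    have "fs ! i \<in> hom (theory_cat P) ms [ns ! i]" if "i < length ns" for i
      using that ts unfolding mem_hom1_theory_cat by (auto simp: fs)
    moreover have "F \<in> hom (theory_cat P) ms ns"
      using ts unfolding mem_hom_theory_cat F by blast
    ultimately show "is_tuple (theory_cat P) (canonical_functor P) ms ns fs F"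
      using ts by (simp add: is_tuple_def F proj fs)
  qed
qed

section \<open>Quotation of terms of \<open>E\<close> in the internal language\<close>

locale presentation =
  fixes E :: "'o presentation"
  assumes wf_E: "wf_presentation E"
begin

abbreviation Q :: "'o arrow presentation" where
  "Q \<equiv> internal_language (theory_cat E) (canonical_functor E)"

text \<open>This is \<lceil>t\<rceil>. The context is an explicit argument because it determines the
  source and target of the arrow.\<close>

definition quote :: "nat list \<Rightarrow> nat \<Rightarrow> 'o tm \<Rightarrow> 'o arrow tm" where
  "quote \<Theta> n t = op_tm (theory_cat E) (arrow1 E \<Theta> n t)"

lemma quote_eq:
  "quote \<Theta> n t = Op (arrow1 E \<Theta> n t) (zip \<Theta> (generic_metas \<Theta>) @ map (\<lambda>j. (0, Var j)) [0..<n])"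
  by (simp add: quote_def op_tm_def)

lemma quote_cong: "derives E \<Theta> n s t \<Longrightarrow> quote \<Theta> n s = quote \<Theta> n t"
  by (simp add: quote_def arrow1_cong)

lemma msub_quote:
  assumes "map fst \<sigma> = \<Theta>"
  shows "msub \<sigma> (quote \<Theta> n t) = Op (arrow1 E \<Theta> n t) (\<sigma> @ map (\<lambda>j. (0, Var j)) [0..<n])"
  using msub_args_generic_metas[OF assms] by (simp add: quote_eq)

lemma ops_Q: "f \<in> ops Q \<longleftrightarrow> (\<exists>\<Theta> n t. wf_tm E \<Theta> n t \<and> f = arrow1 E \<Theta> n t)"
  by (auto simp: internal_language_def mem_hom1_theory_cat)

lemma arity_Q [simp]: "arity Q (arrow1 E \<Theta> n t) = \<Theta> @ replicate n 0"
  by (simp add: internal_language_def)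

lemma wf_quote:
  assumes "wf_tm E \<Theta> n t"
  shows "wf_tm Q \<Theta> n (quote \<Theta> n t)"
proof -
  have "wf_tm Q \<Theta> (m + n) s" if "(m, s) \<in> set (zip \<Theta> (generic_metas \<Theta>))" for m s
    using that by (auto simp: set_zip)
  then show ?thesis
    using assms unfolding quote_eq by (auto simp: ops_Q comp_def map_replicate_const)
qed

text \<open>Every arrow involved is a tuple of classes of terms, so both families can be indexed by
  terms: the functor, tuples and composition are replaced by their values computed above.\<close>

lemma axioms_Q:
  "axioms Q =
    {(\<Theta>, n, embed s, quote \<Theta> n (embed s)) | \<Theta> n s. wf_tm empty_presentation \<Theta> n s} \<union>
    {(\<Theta>, n, quote \<Theta> n (msub (zip \<Xi> ts) u), msub (zip \<Xi> (map2 (quote \<Theta>) \<Xi> ts)) (quote \<Xi> n u)) |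
      \<Theta> \<Xi> n ts u. wf_tm E \<Xi> n u \<and> length ts = length \<Xi> \<and>
        (\<forall>i < length \<Xi>. wf_tm E \<Theta> (\<Xi> ! i) (ts ! i))}" (is "_ = ?A \<union> ?B")
proof -
  have "{(ms, n, embed s, op_tm (theory_cat E) (canonical_functor E (arrow1 empty_presentation ms n s)))
      | ms n s. wf_tm empty_presentation ms n s} = ?A"
    by (intro Collect_cong ex_cong1) (auto simp: quote_def canonical_functor_arrow1)
  moreover have "{(ms, n, op_tm (theory_cat E) h,
      msub (zip ns (map (op_tm (theory_cat E)) fs)) (op_tm (theory_cat E) g)) | ms ns n fs F g h.
         is_tuple (theory_cat E) (canonical_functor E) ms ns fs F \<and>
         g \<in> hom (theory_cat E) ns [n] \<and> h = cmp (theory_cat E) g F} = ?B" (is "?B' = _")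
  proof
    show "?B' \<subseteq> ?B"
    proof
      fix x assume "x \<in> ?B'"
      then obtain ms ns n fs F g where x: "x = (ms, n, op_tm (theory_cat E) (cmp (theory_cat E) g F),
          msub (zip ns (map (op_tm (theory_cat E)) fs)) (op_tm (theory_cat E) g))"
        and tup: "is_tuple (theory_cat E) (canonical_functor E) ms ns fs F"
        and "g \<in> hom (theory_cat E) ns [n]" by blast
      then obtain u where u: "wf_tm E ns n u" "g = arrow1 E ns n u"
        by (auto simp: mem_hom1_theory_cat)
      obtain ts where ts: "length ts = length ns" "\<forall>i < length ns. wf_tm E ms (ns ! i) (ts ! i)"
        "F = arrow_of E ms ns ts" "fs = map2 (arrow1 E ms) ns ts"
        using tup unfolding is_tuple_theory_cat[OF wf_E] by blast
      have "x = (ms, n, quote ms n (msub (zip ns ts) u),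
          msub (zip ns (map2 (quote ms) ns ts)) (quote ns n u))"
        using u ts by (simp add: x quote_def cmp_theory_cat[OF wf_E] comp_def case_prod_unfold)
      with u ts show "x \<in> ?B" by blast
    qed
    show "?B \<subseteq> ?B'"
    proof
      fix x assume "x \<in> ?B"
      then obtain ms ns n ts u where x: "x = (ms, n, quote ms n (msub (zip ns ts) u),
          msub (zip ns (map2 (quote ms) ns ts)) (quote ns n u))" and u: "wf_tm E ns n u"
        and ts: "length ts = length ns" "\<forall>i < length ns. wf_tm E ms (ns ! i) (ts ! i)" by blast
      have "x = (ms, n, op_tm (theory_cat E) (cmp (theory_cat E) (arrow1 E ns n u) (arrow_of E ms ns ts)),
          msub (zip ns (map (op_tm (theory_cat E)) (map2 (arrow1 E ms) ns ts)))
            (op_tm (theory_cat E) (arrow1 E ns n u)))"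
        using u ts by (simp add: x quote_def cmp_theory_cat[OF wf_E] comp_def case_prod_unfold)
      moreover have "is_tuple (theory_cat E) (canonical_functor E) ms ns
          (map2 (arrow1 E ms) ns ts) (arrow_of E ms ns ts)"
        using ts unfolding is_tuple_theory_cat[OF wf_E] by blast
      moreover have "arrow1 E ns n u \<in> hom (theory_cat E) ns [n]"
        using u unfolding mem_hom1_theory_cat by blast
      ultimately show "x \<in> ?B'" by blast
    qed
  qed
  ultimately show ?thesis
    unfolding internal_language_def by simp
qed

lemma wf_Q: "wf_presentation Q"
proof -
  have "wf_tm Q \<Theta> n s \<and> wf_tm Q \<Theta> n t" if "(\<Theta>, n, s, t) \<in> axioms Q" for \<Theta> n s t
    using that unfolding axioms_Q
  proof
    assume "(\<Theta>, n, s, t) \<in> {(\<Theta>, n, embed s, quote \<Theta> n (embed s)) | \<Theta> n s.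
      wf_tm empty_presentation \<Theta> n s}"
    then show ?thesis by (auto intro: wf_embed wf_quote)
  next
    assume "(\<Theta>, n, s, t) \<in>
      {(\<Theta>, n, quote \<Theta> n (msub (zip \<Xi> ts) u), msub (zip \<Xi> (map2 (quote \<Theta>) \<Xi> ts)) (quote \<Xi> n u)) |
      \<Theta> \<Xi> n ts u. wf_tm E \<Xi> n u \<and> length ts = length \<Xi> \<and>
        (\<forall>i < length \<Xi>. wf_tm E \<Theta> (\<Xi> ! i) (ts ! i))}"
    then obtain \<Xi> ts u where u: "wf_tm E \<Xi> n u" and len: "length ts = length \<Xi>"
      and ts: "\<And>i. i < length \<Xi> \<Longrightarrow> wf_tm E \<Theta> (\<Xi> ! i) (ts ! i)"
      and s: "s = quote \<Theta> n (msub (zip \<Xi> ts) u)"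
      and t: "t = msub (zip \<Xi> (map2 (quote \<Theta>) \<Xi> ts)) (quote \<Xi> n u)"
      by blast
    have "wf_tm E \<Theta> n (msub (zip \<Xi> ts) u)"
      by (rule wf_msub_zip[OF u len ts])
    moreover have "wf_tm Q \<Theta> n t"
      unfolding t
      by (rule wf_msub_zip[OF wf_quote[OF u]]) (use len ts in \<open>auto intro: wf_quote\<close>)
    ultimately show ?thesis by (simp add: s wf_quote)
  qed
  then show ?thesis by (auto simp: wf_presentation_def)
qed

section \<open>The isomorphism\<close>

text \<open>Packages derivable equality with \<lceil>t\<rceil> as a relation between terms of
  \<open>Q\<close> and of \<open>E\<close>. Its closure properties turn the two axiom families into
  rules usable in inductions.\<close>

definition denotes :: "nat list \<Rightarrow> nat \<Rightarrow> 'o arrow tm \<Rightarrow> 'o tm \<Rightarrow> bool" where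
  "denotes \<Theta> n a t \<longleftrightarrow> wf_tm E \<Theta> n t \<and> derives Q \<Theta> n a (quote \<Theta> n t)"

lemma denotes_wf: "denotes \<Theta> n a t \<Longrightarrow> wf_tm Q \<Theta> n a \<and> wf_tm E \<Theta> n t"
  using derives_wf[OF wf_Q] unfolding denotes_def by blast

lemma denotes_quote: "wf_tm E \<Theta> n t \<Longrightarrow> denotes \<Theta> n (quote \<Theta> n t) t"
  by (simp add: denotes_def derives.refl wf_quote)

lemma denotes_embed:
  assumes "wf_tm empty_presentation \<Theta> n s"
  shows "denotes \<Theta> n (embed s) (embed s)"
proof -
  have "(\<Theta>, n, embed s, quote \<Theta> n (embed s)) \<in> axioms Q"
    unfolding axioms_Q using assms by blast
  then show ?thesis
    by (simp add: denotes_def wf_embed assms derives.ax)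
qed

lemma denotes_Meta0:
  assumes "i < length \<Theta>" and "\<Theta> ! i = 0"
  shows "denotes \<Theta> n (Meta i []) (Meta i [])"
  using denotes_embed[of \<Theta> n "Meta i []"] assms by simp

lemma denotes_meta_vars:
  assumes "i < length \<Theta>"
  shows "denotes \<Theta> (\<Theta> ! i) (meta_vars (\<Theta> ! i) i) (meta_vars (\<Theta> ! i) i)"
  using denotes_embed[of \<Theta> "\<Theta> ! i" "meta_vars (\<Theta> ! i) i"] assms
  by simp (simp add: meta_vars_def comp_def)

text \<open>Congruence replaces all parts by quotations; the composition axiom, read from right to
  left, then merges them into one.\<close>

lemma denotes_msub:
  assumes t: "denotes \<Xi> n a t" and len: "length as = length \<Xi>" "length ts = length \<Xi>"
    and ts: "\<And>i. i < length \<Xi> \<Longrightarrow> denotes \<Theta> (\<Xi> ! i) (as ! i) (ts ! i)"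
  shows "denotes \<Theta> n (msub (zip \<Xi> as) a) (msub (zip \<Xi> ts) t)"
proof -
  have wf: "wf_tm E \<Xi> n t" "\<And>i. i < length \<Xi> \<Longrightarrow> wf_tm E \<Theta> (\<Xi> ! i) (ts ! i)"
    using t ts by (auto simp: denotes_def)
  have "derives Q \<Theta> n (msub (zip \<Xi> as) a) (msub (zip \<Xi> (map2 (quote \<Theta>) \<Xi> ts)) (quote \<Xi> n t))"
    by (rule derives_msub[OF wf_Q]) (use t ts len in \<open>auto simp: denotes_def\<close>)
  moreover have "(\<Theta>, n, quote \<Theta> n (msub (zip \<Xi> ts) t),
      msub (zip \<Xi> (map2 (quote \<Theta>) \<Xi> ts)) (quote \<Xi> n t)) \<in> axioms Q"
    unfolding axioms_Q using wf len by blast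
  moreover have "wf_tm E \<Theta> n (msub (zip \<Xi> ts) t)"
    by (rule wf_msub_zip[OF wf(1) len(2) wf(2)])
  ultimately show ?thesis
    unfolding denotes_def by (meson derives.ax derives.sym derives.trans)
qed

text \<open>Quoting in a larger context gives another operator in general, so weakening is more than
  a change of typing. It is obtained by composing with generic metavariables, which leaves both
  terms fixed.\<close>

lemma denotes_append_metas:
  assumes "denotes \<Theta> n a t"
  shows "denotes (\<Theta> @ \<Theta>') n a t"
proof -
  have "denotes (\<Theta> @ \<Theta>') (\<Theta> ! i) (meta_vars (\<Theta> ! i) i) (meta_vars (\<Theta> ! i) i)"
    if "i < length \<Theta>" for i
    using denotes_meta_vars[of i "\<Theta> @ \<Theta>'"] that by (simp add: nth_append)
  then have "denotes (\<Theta> @ \<Theta>') n (msub (zip \<Theta> (generic_metas \<Theta>)) a) (msub (zip \<Theta> (generic_metas \<Theta>)) t)"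
    by (intro denotes_msub[OF assms]) auto
  moreover have "wf_tm Q \<Theta> n a" "wf_tm E \<Theta> n t"
    using denotes_wf[OF assms] by auto
  ultimately show ?thesis by (simp add: msub_generic_metas)
qed

text \<open>Closure is available for metasubstitution only, so the substitution is encoded as one,
  into a term without operators. The \<open>m\<close> innermost variables are kept because they will
  be bound by an operator argument.\<close>

lemma denotes_sub_fresh_meta:
  assumes "denotes \<Theta> (m + n) a t"
  shows "denotes (\<Theta> @ replicate n 0) m
    (sub (lift_sub m (fresh_meta (length \<Theta>))) a) (sub (lift_sub m (fresh_meta (length \<Theta>))) t)"
proof -
  define \<Xi> where "\<Xi> = (m + n) # replicate n (0 :: nat)"
  \<comment> \<open>The term is m_1[x_1,...,x_m, m_2[],...,m_(n+1)[]]; the first metavariable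
    receives the given term, the others the fresh ones.\<close>
  define e :: "unit tm" where
    "e = Meta 0 (map Var [0..<m] @ map (\<lambda>j. Meta (Suc j) []) [0..<n])"
  have "denotes \<Xi> m (embed e) (embed e)"
    by (rule denotes_embed) (auto simp: e_def \<Xi>_def)
  then have "denotes (\<Theta> @ replicate n 0) m
      (msub (zip \<Xi> (a # map (fresh_meta (length \<Theta>)) [0..<n])) (embed e))
      (msub (zip \<Xi> (t # map (fresh_meta (length \<Theta>)) [0..<n])) (embed e))"
  proof (rule denotes_msub)
    fix i assume "i < length \<Xi>"
    then show "denotes (\<Theta> @ replicate n 0) (\<Xi> ! i)
        ((a # map (fresh_meta (length \<Theta>)) [0..<n]) ! i)
        ((t # map (fresh_meta (length \<Theta>)) [0..<n]) ! i)"
      by (cases i) (simp_all add: \<Xi>_def fresh_meta_def denotes_append_metas[OF assms]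
          denotes_Meta0 nth_append)
  qed (simp_all add: \<Xi>_def)
  \<comment> \<open>Stated for an arbitrary signature, since it serves both \<open>a\<close> over
    \<open>Q\<close> and \<open>t\<close> over \<open>E\<close>.\<close>
  moreover have *: "msub (zip \<Xi> (b # map (fresh_meta (length \<Theta>)) [0..<n])) (embed e)
      = sub (lift_sub m (fresh_meta (length \<Theta>))) b" if "wf_tm S \<Theta> (m + n) b"
    for S :: "('c, 'z) signature_scheme" and b
    unfolding e_def \<Xi>_def lift_sub_fresh_meta
    by (simp add: msub_Meta comp_def)
      (rule sub_cong_wf[OF that], auto simp: inst_def nth_append fresh_meta_def msub_Meta)
  moreover have "wf_tm Q \<Theta> (m + n) a" "wf_tm E \<Theta> (m + n) t"
    using denotes_wf[OF assms] by auto
  ultimately show ?thesis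
    by (simp only: *)
qed

section \<open>The translations in both directions\<close>

definition to_Q :: "('o, 'o arrow) translation" where
  "to_Q f = quote (arity E f) 0 (id_translation E f)"

text \<open>An arrow into a single arity has one component, taken by \<open>hd\<close>. A
  translation must send an operator to a term without variables, which \<open>fresh_meta\<close>
  achieves.\<close>

definition from_Q :: "('o arrow, 'o) translation" where
  "from_Q f = sub (fresh_meta (length (src f))) (rep (hd (comps f)))"

lemma wf_id_translation:
  assumes "f \<in> ops P"
  shows "wf_tm P (arity P f) n (id_translation P f)"
  using assms by (auto simp: id_translation_def set_zip)

text \<open>
  The operators of \<open>Q\<close> take arrows with the bound variables of the arguments only, so an
  operator of \<open>E\<close> cannot be composed directly with arguments that also depend on the
  variables of the context. These are therefore exchanged for fresh metavariables of arity
  \<open>0\<close> before the composition axiom is used, and restored afterwards.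
\<close>

lemma denotes_translate:
  assumes "wf_tm E \<Theta> n t"
  shows "denotes \<Theta> n (translate to_Q t) t"
  using assms
proof (induction rule: wf_tm.induct)
  case (wf_Var x n)
  then show ?case using denotes_embed[of \<Theta> n "Var x"] by simp
next
  case (wf_Meta i ts n)
  define \<Xi> where "\<Xi> = \<Theta> ! i # replicate (length ts) n"
  \<comment> \<open>To use closure under metasubstitution, \<open>Meta i ts\<close> is written as an
    instance of m_1[m_2[x_1,...,x_n],...]: the head becomes the generic application of
    \<open>Meta i\<close>, the others become the terms \<open>ts\<close>.\<close>
  define e :: "unit tm" where
    "e = Meta 0 (map (\<lambda>j. meta_vars n (Suc j)) [0..<length ts])"
  have "denotes \<Xi> n (embed e) (embed e)"
    by (rule denotes_embed) (use wf_Meta in \<open>auto simp: e_def \<Xi>_def\<close>)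
  then have "denotes \<Theta> n
      (msub (zip \<Xi> (meta_vars (\<Theta> ! i) i # map (translate to_Q) ts)) (embed e))
      (msub (zip \<Xi> (meta_vars (\<Theta> ! i) i # ts)) (embed e))"
  proof (rule denotes_msub)
    fix j assume "j < length \<Xi>"
    then show "denotes \<Theta> (\<Xi> ! j) ((meta_vars (\<Theta> ! i) i # map (translate to_Q) ts) ! j)
        ((meta_vars (\<Theta> ! i) i # ts) ! j)"
      by (cases j) (simp_all add: \<Xi>_def denotes_meta_vars wf_Meta)
  qed (simp_all add: \<Xi>_def)
  moreover have *: "msub (zip \<Xi> (meta_vars (\<Theta> ! i) i # us)) (embed e) = Meta i us"
    if wf: "\<And>u. u \<in> set us \<Longrightarrow> wf_tm S \<Theta> n u" and len: "length us = length ts"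
    for S :: "('c, 'z) signature_scheme" and us
  proof -
    have e: "(embed e :: 'c tm) = Meta 0 (map (\<lambda>j. meta_vars n (Suc j)) [0..<length ts])"
      by (simp add: e_def meta_vars_def comp_def)
    have "map (msub (zip \<Xi> (meta_vars (\<Theta> ! i) i # us)))
        (map (\<lambda>j. meta_vars n (Suc j)) [0..<length ts]) = us"
    proof (rule nth_equalityI)
      fix j assume "j < length (map (msub (zip \<Xi> (meta_vars (\<Theta> ! i) i # us)))
        (map (\<lambda>j. meta_vars n (Suc j)) [0..<length ts]))"
      then show "map (msub (zip \<Xi> (meta_vars (\<Theta> ! i) i # us)))
        (map (\<lambda>j. meta_vars n (Suc j)) [0..<length ts]) ! j = us ! j"
        using msub_meta_vars_closed[of "Suc j" \<Xi> "meta_vars (\<Theta> ! i) i # us" S \<Theta>] wf len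
        by (simp add: \<Xi>_def)
    qed (simp add: len)
    then show ?thesis
      unfolding e msub_Meta
      using wf_Meta(2) len by (simp add: \<Xi>_def meta_vars_def comp_def map_inst)
  qed
  moreover have "wf_tm Q \<Theta> n s" if "s \<in> set (map (translate to_Q) ts)" for s
    using that denotes_wf[OF wf_Meta.IH] by auto
  ultimately show ?case
    using *[of "map (translate to_Q) ts" Q] *[of ts E] wf_Meta.hyps by simp
next
  case (wf_Op f as n)
  define ms where "ms = arity E f"
  define k where "k = length \<Theta>"
  define \<Theta>' where "\<Theta>' = \<Theta> @ replicate n (0 :: nat)"
  define u where "u = Op f as"
  have as: "map fst as = ms"
    using wf_Op by (simp add: ms_def)
  have den_f: "denotes ms 0 (to_Q f) (id_translation E f)"
    unfolding to_Q_def ms_def by (intro denotes_quote wf_id_translation wf_Op)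
  then have to_Q: "wf_tm Q ms 0 (to_Q f)"
    using denotes_wf by blast
  have wf_u: "wf_tm E \<Theta> n u"
    using wf_Op by (auto simp: u_def)
  have map_pair: "zip ms (map h as) = map (\<lambda>p. (fst p, h p)) as" for h :: "nat \<times> 'o tm \<Rightarrow> 'c"
    by (simp add: as[symmetric] zip_map_map zip_same_conv_map)
  \<comment> \<open>After the exchange each argument contains only its own bound variables, so the
    composition axiom applies to the operator and its arguments.\<close>
  have "denotes \<Theta>' 0
      (msub (zip ms (map (\<lambda>(m, t). sub (lift_sub m (fresh_meta k)) (translate to_Q t)) as)) (to_Q f))
      (msub (zip ms (map (\<lambda>(m, t). sub (lift_sub m (fresh_meta k)) t) as)) (id_translation E f))"
  proof (rule denotes_msub[OF den_f])
    fix i assume "i < length ms"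
    then have i: "i < length as" and m: "ms ! i = fst (as ! i)"
      by (auto simp: as[symmetric])
    have "denotes \<Theta> (fst (as ! i) + n) (translate to_Q (snd (as ! i))) (snd (as ! i))"
      by (rule wf_Op.IH) (use i in simp)
    from denotes_sub_fresh_meta[OF this] i m
    show "denotes \<Theta>' (ms ! i)
        (map (\<lambda>(m, t). sub (lift_sub m (fresh_meta k)) (translate to_Q t)) as ! i)
        (map (\<lambda>(m, t). sub (lift_sub m (fresh_meta k)) t) as ! i)"
      by (simp add: \<Theta>'_def k_def case_prod_unfold)
  qed (auto simp: as[symmetric])
  moreover have "sub (fresh_meta k) (translate to_Q u)
      = msub (zip ms (map (\<lambda>(m, t). sub (lift_sub m (fresh_meta k)) (translate to_Q t)) as)) (to_Q f)"
    using sub_msub_closed[OF to_Q, of "map (\<lambda>(m, t). (m, translate to_Q t)) as"] as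
    by (simp add: u_def map_pair comp_def case_prod_unfold)
  moreover have "sub (fresh_meta k) u
      = msub (zip ms (map (\<lambda>(m, t). sub (lift_sub m (fresh_meta k)) t) as)) (id_translation E f)"
    using as by (subst msub_id_translation)
      (auto simp: u_def map_pair comp_def case_prod_unfold simp flip: ms_def)
  ultimately have "denotes \<Theta>' 0 (sub (fresh_meta k) (translate to_Q u)) (sub (fresh_meta k) u)"
    by simp
  \<comment> \<open>The quotation of \<open>u\<close>, after the same exchange, denotes the same
    term; hence the two sides are derivably equal, and it remains to restore the variables.\<close>
  moreover have "denotes \<Theta>' 0 (sub (fresh_meta k) (quote \<Theta> n u)) (sub (fresh_meta k) u)"
    using denotes_sub_fresh_meta[of \<Theta> 0 n, OF denotes_quote] wf_u
    by (simp add: lift_sub_0_fresh_meta \<Theta>'_def k_def)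
  ultimately have *: "derives Q \<Theta>' 0 (sub (fresh_meta k) (translate to_Q u)) (sub (fresh_meta k) (quote \<Theta> n u))"
    unfolding denotes_def by (meson derives.sym derives.trans)
  have "wf_tm Q \<Theta> n (msub (map (\<lambda>(m, t). (m, translate to_Q t)) as) (to_Q f))"
  proof (rule wf_msub[OF wf_mono[OF to_Q]])
    fix m s assume "(m, s) \<in> set (map (\<lambda>(m, t). (m, translate to_Q t)) as)"
    then obtain t where "(m, t) \<in> set as" "s = translate to_Q t" by auto
    then show "wf_tm Q \<Theta> (m + n) s"
      using denotes_wf[OF wf_Op.IH] by simp
  qed (use as in \<open>auto simp: comp_def case_prod_unfold\<close>)
  then have "wf_tm Q \<Theta> n (translate to_Q u)"
    by (simp add: u_def)
  from derives_unfresh_meta[OF *[unfolded \<Theta>'_def k_def] this wf_quote[OF wf_u]] wf_u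
  show ?case
    by (simp add: denotes_def u_def)
qed

text \<open>The trailing arguments \<open>Var j\<close> instantiate exactly the nullary
  metavariables introduced by \<open>from_Q\<close>, so the variables of the representative
  return.\<close>

lemma translate_from_Q_Op:
  assumes "wf_tm E \<Theta> n t" and "length ss = length \<Theta>"
  shows "translate from_Q (Op (arrow1 E \<Theta> n t) (zip \<Theta> ss @ map (\<lambda>j. (0, Var j)) [0..<n]))
    = msub (zip \<Theta> (map (translate from_Q) ss)) (rep (eq_class E \<Theta> n t))"
proof -
  have wf: "wf_tm E \<Theta> n (rep (eq_class E \<Theta> n t))"
    using derives_wf[OF wf_E derives_rep[OF assms(1)]] by simp
  have "map (\<lambda>(n, t). (n, translate from_Q t)) (zip \<Theta> ss) = zip \<Theta> (map (translate from_Q) ss)"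
    by (simp add: zip_map2)
  then show ?thesis
    using msub_sub_fresh_meta[OF wf, of "map (translate from_Q) ss"] assms(2)
    by (simp add: from_Q_def comp_def)
qed

lemma translate_from_Q_quote:
  assumes "wf_tm E \<Theta> n t"
  shows "translate from_Q (quote \<Theta> n t) = rep (eq_class E \<Theta> n t)"
proof -
  have wf: "wf_tm E \<Theta> n (rep (eq_class E \<Theta> n t))"
    using derives_wf[OF wf_E derives_rep[OF assms(1)]] by simp
  have "map (translate from_Q) (generic_metas \<Theta>) = generic_metas \<Theta>"
    by (rule nth_equalityI) (simp_all add: meta_vars_def)
  then show ?thesis
    using translate_from_Q_Op[OF assms, of "generic_metas \<Theta>"]
    by (simp add: quote_eq msub_generic_metas[OF wf])
qed

text \<open>The two sides of an axiom have the same class, hence literally the same quotation, and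
  each translated side is derivably equal to it.\<close>

lemma is_translation_to_Q: "is_translation E Q to_Q"
proof -
  have "wf_tm Q (arity E f) 0 (to_Q f)" if "f \<in> ops E" for f
    unfolding to_Q_def by (intro wf_quote wf_id_translation that)
  moreover have "derives Q \<Theta> n (translate to_Q s) (translate to_Q t)"
    if "(\<Theta>, n, s, t) \<in> axioms E" for \<Theta> n s t
  proof -
    have st: "derives E \<Theta> n s t"
      using that by (rule derives.ax)
    then have "denotes \<Theta> n (translate to_Q s) s" "denotes \<Theta> n (translate to_Q t) t"
      using derives_wf[OF wf_E] by (auto intro: denotes_translate)
    then show ?thesis
      using quote_cong[OF st] unfolding denotes_def by (metis derives.sym derives.trans)
  qed
  ultimately show ?thesis by (auto simp: is_translation_def)
qed

lemma is_translation_from_Q: "is_translation Q E from_Q"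
proof -
  have "wf_tm E (arity Q f) 0 (from_Q f)" if f: "f \<in> ops Q" for f
  proof -
    obtain \<Theta> n t where t: "wf_tm E \<Theta> n t" and f: "f = arrow1 E \<Theta> n t"
      using f by (auto simp: ops_Q)
    have "wf_tm E \<Theta> n (rep (eq_class E \<Theta> n t))"
      using derives_wf[OF wf_E derives_rep[OF t]] by simp
    from wf_sub_fresh_meta[OF this] show ?thesis
      unfolding f arity_Q by (simp add: from_Q_def)
  qed
  moreover have "derives E \<Theta> n (translate from_Q s) (translate from_Q t)"
    if "(\<Theta>, n, s, t) \<in> axioms Q" for \<Theta> n s t
    using that unfolding axioms_Q
  proof
    assume "(\<Theta>, n, s, t) \<in> {(\<Theta>, n, embed s, quote \<Theta> n (embed s)) | \<Theta> n s.
      wf_tm empty_presentation \<Theta> n s}"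
    then show ?thesis
      by (auto simp: translate_embed translate_from_Q_quote wf_embed intro!: derives_rep)
  next
    assume "(\<Theta>, n, s, t) \<in>
      {(\<Theta>, n, quote \<Theta> n (msub (zip \<Xi> ts) u), msub (zip \<Xi> (map2 (quote \<Theta>) \<Xi> ts)) (quote \<Xi> n u)) |
      \<Theta> \<Xi> n ts u. wf_tm E \<Xi> n u \<and> length ts = length \<Xi> \<and>
        (\<forall>i < length \<Xi>. wf_tm E \<Theta> (\<Xi> ! i) (ts ! i))}"
    then obtain \<Xi> ts u where u: "wf_tm E \<Xi> n u" and len: "length ts = length \<Xi>"
      and ts: "\<And>i. i < length \<Xi> \<Longrightarrow> wf_tm E \<Theta> (\<Xi> ! i) (ts ! i)"
      and s: "s = quote \<Theta> n (msub (zip \<Xi> ts) u)"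
      and t: "t = msub (zip \<Xi> (map2 (quote \<Theta>) \<Xi> ts)) (quote \<Xi> n u)"
      by blast
    define rs where "rs = map2 (\<lambda>m t. rep (eq_class E \<Theta> m t)) \<Xi> ts"
    have wf: "wf_tm E \<Theta> n (msub (zip \<Xi> ts) u)"
      by (rule wf_msub_zip[OF u len ts])
    have "map (translate from_Q) (map2 (quote \<Theta>) \<Xi> ts) = rs"
      using len ts by (intro nth_equalityI) (simp_all add: rs_def translate_from_Q_quote)
    then have "translate from_Q t = msub (zip \<Xi> rs) (rep (eq_class E \<Xi> n u))"
      using translate_from_Q_Op[OF u, of "map2 (quote \<Theta>) \<Xi> ts"] len
      by (simp add: t msub_quote)
    \<comment> \<open>Composing and then choosing a representative agrees with composing chosen
      representatives, by congruence of metasubstitution.\<close>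
    moreover have "derives E \<Theta> n (msub (zip \<Xi> ts) u) (msub (zip \<Xi> rs) (rep (eq_class E \<Xi> n u)))"
      by (rule derives_msub[OF wf_E derives_rep[OF u]])
        (use len ts in \<open>auto simp: rs_def intro: derives_rep\<close>)
    ultimately show ?thesis
      using derives_rep[OF wf] unfolding s translate_from_Q_quote[OF wf]
      by (metis derives.sym derives.trans)
  qed
  ultimately show ?thesis by (auto simp: is_translation_def)
qed

section \<open>The composites are identities\<close>

lemma from_Q_to_Q: "same_morphism E E (comp_translation from_Q to_Q) (id_translation E)"
  unfolding same_morphism_def comp_translation_def to_Q_def
  by (simp add: translate_from_Q_quote wf_id_translation derives.sym[OF derives_rep])

text \<open>The trailing arguments x_1,...,x_n of \<lceil>t\<rceil> turn into the nullary
  metavariables that the zeros in the arity of its operator call for.\<close>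

lemma sub_fresh_meta_quote:
  "sub (fresh_meta (length \<Theta>)) (quote \<Theta> n t) = id_translation Q (arrow1 E \<Theta> n t)"
proof -
  have "map (\<lambda>(m, s). (m, sub (lift_sub m (fresh_meta (length \<Theta>))) s))
      (zip \<Theta> (generic_metas \<Theta>) @ map (\<lambda>j. (0, Var j)) [0..<n])
    = zip (\<Theta> @ replicate n 0) (generic_metas (\<Theta> @ replicate n 0))" (is "?l = ?r")
  proof (rule nth_equalityI)
    fix i assume i: "i < length ?l"
    show "?l ! i = ?r ! i"
    proof (cases "i < length \<Theta>")
      case True
      then show ?thesis
        by (simp add: nth_append meta_vars_def lift_sub_fresh_meta)
    next
      case False
      with i show ?thesis
        by (simp add: nth_append meta_vars_def lift_sub_fresh_meta)
    qed
  qed simp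
  then show ?thesis by (simp add: quote_eq id_translation_def)
qed

text \<open>Both sides denote the representative with its variables exchanged: one by
  \<open>denotes_translate\<close>, the other because the identity on an operator is an exchanged
  quotation.\<close>

lemma to_Q_from_Q: "same_morphism Q Q (comp_translation to_Q from_Q) (id_translation Q)"
  unfolding same_morphism_def comp_translation_def
proof
  fix f assume "f \<in> ops Q"
  then obtain \<Theta> n t where t: "wf_tm E \<Theta> n t" and f: "f = arrow1 E \<Theta> n t"
    by (auto simp: ops_Q)
  define r where "r = rep (eq_class E \<Theta> n t)"
  have tr: "derives E \<Theta> n t r"
    unfolding r_def by (rule derives_rep[OF t])
  have r: "wf_tm E \<Theta> n r"
    using derives_wf[OF wf_E tr] by simp
  have "denotes (\<Theta> @ replicate n 0) 0 (translate to_Q (from_Q f)) (sub (fresh_meta (length \<Theta>)) r)"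
    using denotes_translate[OF wf_sub_fresh_meta[OF r]] by (simp add: from_Q_def f r_def)
  moreover have "denotes (\<Theta> @ replicate n 0) 0 (id_translation Q f) (sub (fresh_meta (length \<Theta>)) r)"
    using denotes_sub_fresh_meta[of \<Theta> 0 n, OF denotes_quote] r
    by (simp add: lift_sub_0_fresh_meta f sub_fresh_meta_quote[symmetric] quote_cong[OF tr])
  ultimately show "derives Q (arity Q f) 0 (translate to_Q (from_Q f)) (id_translation Q f)"
    unfolding denotes_def f arity_Q by (meson derives.sym derives.trans)
qed

end

theorem theorem2:
  fixes E :: "'o presentation"
  assumes "wf_presentation E"
  shows "SOEP_isomorphic E (internal_language (theory_cat E) (canonical_functor E))"
proof -
  interpret presentation E by unfold_locales (rule assms)
  show ?thesis
    unfolding SOEP_isomorphic_def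
    using assms wf_Q is_translation_to_Q is_translation_from_Q from_Q_to_Q to_Q_from_Q by blast
qed

end
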